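(* Let $p$ be an odd prime, $1\le m<n$, $\bar B\subseteq[n]\setminus[m]$ with $|\bar B|=b\ge1$, and let $I$ be the generalized order ideal of $\mathbb{GH}(m,n)$, of type (U) (unsaturated) or (S) (saturated), in which every element of $[m]\cup\bar B$ has multiplicity $p-1$ and all other elements have multiplicity $0$. Let $f:\mathbb{F}_p^n\to\mathbb{F}_p$ be the characteristic function of $I(\mathbb{GP})\setminus\{0\}$ and, for $s\in\mathbb{F}_p$, $u\in\mathbb{F}_p^n$, let $c(s,u)=(sf(x)+u\cdot x)_{x\in\mathbb{F}_p^n\setminus0}$. Put $Q=(p-1)p^{n-1}$, and write $u=(v,w)$ with $v\in\mathbb{F}_p^m$, $w\in\mathbb{F}_p^{n-m}$, $k=\mathrm{wt}(v)$, $\sigma=\sum_{i\le m}v_i\in\mathbb{F}_p$, and $\delta=1$ if the restriction of $w$ to the coordinates in $\bar B$ is zero, $\delta=0$ otherwise. Then $\mathrm{wt}(c(0,u))=Q$ for $u\ne0$, $\mathrm{wt}(c(s,0))=|I(\mathbb{GP})|-1$ for $s\ne0$, and for $s\ne0$, $u\ne0$, \[ \mathrm{wt}(c(s,u))=Q-1+p^m[v=0]+\Phi,\qquad \Phi=\begin{cases}(-1)^k(p-1)^{m-k}(p^b\delta-1)&\text{in case (U)},\\ (p^b\delta-1)\big([\sigma=0]-[\sigma=s]\big)&\text{in case (S)}.\end{cases} \]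
   Context: $[n]=\{1,\dots,n\}$; $[\,\cdot\,]$ applied to a condition is $1$ if it holds and $0$ otherwise; $u\cdot x=\sum_i u_ix_i$; $\mathrm{wt}$ is Hamming weight. Generalized order ideals: $[n]_{p-1}$ is the multiset in which each $i\in[n]$ has multiplicity $p-1$. A sub-multiset $J$ is identified with its multiplicity vector $(J_1,\dots,J_n)\in\{0,\dots,p-1\}^n=\mathbb{F}_p^n$; $J\subseteq J'$ means $J_i\le J'_i$ (as integers) for all $i$; $\bar J=\{i:J_i\ne0\}$. The hierarchical poset $\mathbb{H}(m,n)$ on $[n]$ has as its only strict relations $i\prec j$ for all $i\in[m]$, $j\in[n]\setminus[m]$; $\mathbb{GH}(m,n)$ denotes $[n]_{p-1}$ together with this order. $J$ is an unsaturated generalized order ideal (U) if $\bar J$ is an order ideal (down-closed subset) of $\mathbb{H}(m,n)$; it is a saturated generalized order ideal (S) if moreover $J_i=p-1$ whenever $j\in\bar J$ and $i\prec j$. For a generalized order ideal $I$ of either type, $I(\mathbb{GP})\subseteq\mathbb{F}_p^n$ is the set of all generalized order ideals of the same type contained in $I$. *)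

theory Defs
  imports
    "Berlekamp_Zassenhaus.Finite_Field"
    "HOL-Library.FuncSet"
    "HOL-Library.Indicator_Function"
    "HOL-Library.Multiset"
begin

text \<open>The field with \<open>p\<close> elements is \<^typ>\<open>'p mod_ring\<close> for \<^typ>\<open>'p::prime_card\<close> with \<open>CARD('p) = p\<close>.
  Vectors with coordinates indexed by a set \<open>A\<close> are extensional functions on \<open>A\<close>.\<close>

definition vecs :: "'i set \<Rightarrow> ('i \<Rightarrow> 'a) set" where
  "vecs A = A \<rightarrow>\<^sub>E UNIV"

definition zero_vec :: "'i set \<Rightarrow> 'i \<Rightarrow> 'a::zero" where
  "zero_vec A = (\<lambda>i\<in>A. 0)"

definition hamming_wt :: "'i set \<Rightarrow> ('i \<Rightarrow> 'a::zero) \<Rightarrow> nat" where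
  "hamming_wt A x = card {i\<in>A. x i \<noteq> 0}"

definition dot :: "'i set \<Rightarrow> ('i \<Rightarrow> 'a::comm_semiring_0) \<Rightarrow> ('i \<Rightarrow> 'a) \<Rightarrow> 'a" where
  "dot A u x = (\<Sum>i\<in>A. u i * x i)"

text \<open>A finite poset is given by its ground set and its strict order relation.\<close>

definition order_ideal :: "'i set \<Rightarrow> ('i \<Rightarrow> 'i \<Rightarrow> bool) \<Rightarrow> 'i set \<Rightarrow> bool" where
  "order_ideal P lt A \<longleftrightarrow> A \<subseteq> P \<and> (\<forall>j\<in>A. \<forall>i\<in>P. lt i j \<longrightarrow> i \<in> A)"

definition hier_less :: "nat \<Rightarrow> nat \<Rightarrow> nat \<Rightarrow> nat \<Rightarrow> bool" where
  "hier_less m n i j \<longleftrightarrow> i \<in> {1..m} \<and> j \<in> {1..n} - {1..m}"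

definition uniform_mset :: "nat \<Rightarrow> 'i set \<Rightarrow> 'i multiset" where
  "uniform_mset r A = repeat_mset r (mset_set A)"

datatype ideal_type = Unsaturated | Saturated

text \<open>Generalized order ideals of the multiset in which every element of the poset \<open>(P, lt)\<close>
  has multiplicity \<open>r\<close>; the support \<open>{i. J\<^sub>i \<noteq> 0}\<close> of \<open>J\<close> is \<open>set_mset J\<close>.\<close>

fun gen_order_ideal ::
  "ideal_type \<Rightarrow> nat \<Rightarrow> 'i set \<Rightarrow> ('i \<Rightarrow> 'i \<Rightarrow> bool) \<Rightarrow> 'i multiset \<Rightarrow> bool" where
  "gen_order_ideal Unsaturated r P lt J \<longleftrightarrow>
     J \<subseteq># uniform_mset r P \<and> order_ideal P lt (set_mset J)"
| "gen_order_ideal Saturated r P lt J \<longleftrightarrow>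
     J \<subseteq># uniform_mset r P \<and> order_ideal P lt (set_mset J) \<and>
     (\<forall>j\<in>set_mset J. \<forall>i\<in>P. lt i j \<longrightarrow> count J i = r)"

text \<open>The identification of sub-multisets of \<open>P\<close> with all multiplicities at most \<open>p - 1\<close> with
  vectors over the field with \<open>p\<close> elements; it is injective on such multisets.\<close>

definition mult_vec :: "'i set \<Rightarrow> 'i multiset \<Rightarrow> 'i \<Rightarrow> 'p::prime_card mod_ring" where
  "mult_vec P J = (\<lambda>i\<in>P. of_nat (count J i))"

definition ideals_within ::
  "ideal_type \<Rightarrow> 'i set \<Rightarrow> ('i \<Rightarrow> 'i \<Rightarrow> bool) \<Rightarrow> 'i multiset \<Rightarrow> ('i \<Rightarrow> 'p::prime_card mod_ring) set" where
  "ideals_within T P lt I =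
     mult_vec P ` {J. gen_order_ideal T (CARD('p) - 1) P lt J \<and> J \<subseteq># I}"

text \<open>The entry of the codeword \<open>c(s,u)\<close> at position \<open>x\<close>; the positions are the nonzero vectors.\<close>

definition codeword ::
  "'i set \<Rightarrow> (('i \<Rightarrow> 'a) \<Rightarrow> 'a) \<Rightarrow> 'a \<Rightarrow> ('i \<Rightarrow> 'a) \<Rightarrow> ('i \<Rightarrow> 'a::comm_semiring_0) \<Rightarrow> 'a" where
  "codeword A f s u = (\<lambda>x \<in> vecs A - {zero_vec A}. s * f x + dot A u x)"

definition codeword_wt ::
  "'i set \<Rightarrow> (('i \<Rightarrow> 'a) \<Rightarrow> 'a) \<Rightarrow> 'a \<Rightarrow> ('i \<Rightarrow> 'a::comm_semiring_0) \<Rightarrow> nat" where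
  "codeword_wt A f s u = hamming_wt (vecs A - {zero_vec A}) (codeword A f s u)"

end

theory Submission
  imports Defs
begin

text \<open>Let \<open>D = I(GP)\<close>, which contains \<open>0\<close>, and let \<open>g c = [c = 0] - [c = - s]\<close>. For \<open>s \<noteq> 0\<close>, adding
  \<open>s f\<close> to the linear word \<open>u \<cdot> x\<close> changes only the entries at \<open>x \<in> D - {0}\<close>, and there it changes the
  indicator of a nonzero entry by \<open>g (u \<cdot> x)\<close>; since \<open>g 0 = 1\<close>, this gives
  \<open>wt (c(s,u)) = wt (c(0,u)) - 1 + (\<Sum>x\<in>D. g (u \<cdot> x))\<close> (\<open>codeword_wt_indicator\<close>). For \<open>u = 0\<close> the sum is
  \<open>|D|\<close>, and for \<open>u \<noteq> 0\<close> the weight \<open>wt (c(0,u))\<close> is the usual \<open>(p - 1) p^(n-1)\<close>.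

  An ideal contained in \<open>I\<close> either has support in \<open>[m]\<close>, with arbitrary multiplicities, or meets \<open>B\<close>
  and is then full on \<open>[m]\<close>: nonzero everywhere in case (U), and equal to \<open>p - 1 = - 1\<close> everywhere in
  case (S). Hence \<open>D\<close> is a union of two products of coordinate sets (\<open>ideals_within_hier\<close>), whose
  intersection is again such a product. Because \<open>g\<close> sums to zero over the field, for each coordinate set
  \<open>C\<close> that occurs the operator \<open>g \<mapsto> (\<lambda>d. \<Sum>c\<in>C. g (d + a c))\<close> sends \<open>g\<close> to a multiple of a
  translate of \<open>g\<close>:
  \<^item> for the whole field, \<open>p [a = 0] g\<close>;
  \<^item> for the nonzero elements, \<open>(p [a = 0] - 1) g\<close>;
  \<^item> for a singleton \<open>{c}\<close>, the translate of \<open>g\<close> by \<open>a c\<close>.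

  So the sum over a product factorizes (\<open>sum_box\<close>), and inclusion-exclusion yields
  \<open>p^m [v = 0] + E (p^b \<delta> - 1)\<close> with \<open>E = (- 1)^k (p - 1)^(m-k)\<close> in case (U) and
  \<open>E = g (- \<sigma>)\<close> in case (S) (\<open>sum_ideals_hit_diff\<close>).\<close>

section \<open>Sums of a balanced function over products of coordinate sets\<close>

text \<open>If in each coordinate summation over \<open>S i\<close> scales \<open>g\<close> by \<open>\<mu> i\<close> and translates it by \<open>\<tau> i\<close>, then
  the sum of \<open>g\<close> along a linear form over the product of the \<open>S i\<close> is obtained by multiplying the factors
  and adding the translations. The offset \<open>d\<close> is what makes the induction on \<open>A\<close> work.\<close>
lemma sum_box:
  fixes g :: "'a::comm_semiring_0 \<Rightarrow> int"
  assumes "finite A"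
    and step: "\<And>i d. i \<in> A \<Longrightarrow> (\<Sum>c\<in>S i. g (d + u i * c)) = \<mu> i * g (d + \<tau> i)"
  shows "(\<Sum>x\<in>PiE A S. g (d + dot A u x)) = (\<Prod>i\<in>A. \<mu> i) * g (d + (\<Sum>i\<in>A. \<tau> i))"
  using assms
proof (induction A arbitrary: d rule: finite_induct)
  case empty
  then show ?case by (simp add: dot_def)
next
  case (insert j A)
  have IH: "(\<Sum>x\<in>PiE A S. g (e + dot A u x)) = (\<Prod>i\<in>A. \<mu> i) * g (e + (\<Sum>i\<in>A. \<tau> i))" for e
    by (rule insert.IH) (use insert.prems in auto)
  have dot_upd: "dot (insert j A) u (x(j := c)) = u j * c + dot A u x" for x c
  proof -
    have "(\<Sum>i\<in>A. u i * (x(j := c)) i) = (\<Sum>i\<in>A. u i * x i)"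
      using insert.hyps(2) by (intro sum.cong) auto
    then show ?thesis using insert.hyps by (simp add: dot_def)
  qed
  have inj: "inj_on (\<lambda>(c, x). x(j := c)) (S j \<times> PiE A S)"
    using insert.hyps(2) by (intro inj_combinator)
  have "(\<Sum>x\<in>PiE (insert j A) S. g (d + dot (insert j A) u x)) =
      (\<Sum>(c, x)\<in>S j \<times> PiE A S. g (d + (u j * c + dot A u x)))"
    unfolding PiE_insert_eq
    by (subst sum.reindex[OF inj]) (auto intro!: sum.cong simp: dot_upd)
  also have "\<dots> = (\<Sum>c\<in>S j. \<Sum>x\<in>PiE A S. g ((d + u j * c) + dot A u x))"
    by (simp add: sum.cartesian_product add.assoc)
  also have "\<dots> = (\<Sum>c\<in>S j. (\<Prod>i\<in>A. \<mu> i) * g ((d + (\<Sum>i\<in>A. \<tau> i)) + u j * c))"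
    unfolding IH by (simp add: ac_simps)
  also have "\<dots> = (\<Prod>i\<in>A. \<mu> i) * (\<mu> j * g ((d + (\<Sum>i\<in>A. \<tau> i)) + \<tau> j))"
    using insert.prems[of j] by (simp flip: sum_distrib_left)
  also have "\<dots> = (\<Prod>i\<in>insert j A. \<mu> i) * g (d + (\<Sum>i\<in>insert j A. \<tau> i))"
    using insert.hyps by (simp add: ac_simps)
  finally show ?case .
qed

lemma sum_affine_UNIV:
  fixes g :: "'a::{field,finite} \<Rightarrow> int"
  assumes "sum g UNIV = 0"
  shows "(\<Sum>c\<in>UNIV. g (d + a * c)) = int CARD('a) * of_bool (a = 0) * g d"
proof (cases "a = 0")
  case False
  have "bij (\<lambda>c. d + a * c)"
    using False by (intro o_bij[of "\<lambda>y. (y - d) / a"]) (auto simp: fun_eq_iff)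
  then have "(\<Sum>c\<in>UNIV. g (d + a * c)) = sum g UNIV"
    by (rule sum.reindex_bij_betw)
  then show ?thesis using False assms by simp
qed simp

lemma sum_affine_nonzero:
  fixes g :: "'a::{field,finite} \<Rightarrow> int"
  assumes "sum g UNIV = 0"
  shows "(\<Sum>c\<in>UNIV - {0}. g (d + a * c)) = (int CARD('a) * of_bool (a = 0) - 1) * g d"
  using sum_affine_UNIV[OF assms, of d a]
  by (simp add: sum_diff1 algebra_simps)

section \<open>Weights of the codewords\<close>

lemma finite_vecs: "finite A \<Longrightarrow> finite (vecs A :: ('i \<Rightarrow> 'a::finite) set)"
  by (simp add: vecs_def finite_PiE)

lemma int_card_filter: "finite X \<Longrightarrow> int (card {x\<in>X. P x}) = (\<Sum>x\<in>X. of_bool (P x))"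
  by (simp add: sum_of_bool_eq Collect_conj_eq)

lemma dot_zero [simp]: "dot A (zero_vec A) x = 0" "dot A u (zero_vec A) = 0"
  by (simp_all add: dot_def zero_vec_def)

lemma codeword_wt_altdef:
  "codeword_wt A f s u = card {x\<in>vecs A - {zero_vec A}. s * f x + dot A u x \<noteq> 0}"
  by (auto simp: codeword_wt_def hamming_wt_def codeword_def intro!: arg_cong[where f=card])

text \<open>A nonzero linear form vanishes on a fraction \<open>1/q\<close> of the space.\<close>
lemma codeword_wt_linear:
  fixes u :: "'i \<Rightarrow> 'a::{field,finite}"
  assumes "finite A" "u \<in> vecs A" "u \<noteq> zero_vec A"
  shows "codeword_wt A f 0 u = (CARD('a) - 1) * CARD('a) ^ (card A - 1)"
proof -
  let ?q = "int CARD('a)"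
  obtain j where j: "j \<in> A" "u j \<noteq> 0"
    using assms by (fastforce simp: vecs_def zero_vec_def PiE_def extensional_def)
  \<comment> \<open>Balanced over the field, and its sum over all vectors is \<open>q\<close> times the number of zeros of the
    linear form minus the number of vectors.\<close>
  define g :: "'a \<Rightarrow> int" where "g c = ?q * of_bool (c = 0) - 1" for c
  have bal: "sum g UNIV = 0"
    by (simp add: g_def sum_subtractf flip: sum_distrib_left)
  have fin: "finite (vecs A :: ('i \<Rightarrow> 'a) set)" using assms(1) by (rule finite_vecs)
  have "(\<Sum>x\<in>vecs A. g (0 + dot A u x)) = (\<Prod>i\<in>A. ?q * of_bool (u i = 0)) * g (0 + (\<Sum>i\<in>A. 0))"
    unfolding vecs_def using assms(1)
    by (intro sum_box) (auto simp: sum_affine_UNIV[OF bal])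
  then have "(\<Sum>x\<in>vecs A. g (dot A u x)) = 0"
    using j assms(1) by (auto simp: prod_zero_iff)
  then have eq: "?q * int (card {x\<in>vecs A. dot A u x = 0}) = int (card (vecs A :: ('i \<Rightarrow> 'a) set))"
    by (simp add: g_def sum_subtractf int_card_filter[OF fin] flip: sum_distrib_left)
  have cv: "card (vecs A :: ('i \<Rightarrow> 'a) set) = CARD('a) * CARD('a) ^ (card A - 1)"
    using power_minus_mult[of "card A" "CARD('a)", symmetric] assms(1) j
    by (auto simp: vecs_def card_PiE card_gt_0_iff mult.commute simp del: power_minus_mult)
  have c0: "card {x\<in>vecs A. dot A u x = 0} = CARD('a) ^ (card A - 1)"
    using eq unfolding cv by (simp flip: of_nat_mult of_nat_power)
  have "codeword_wt A f 0 u = card (vecs A - {x\<in>vecs A. dot A u x = 0})"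
    by (auto simp: codeword_wt_altdef intro!: arg_cong[where f=card])
  also have "\<dots> = card (vecs A :: ('i \<Rightarrow> 'a) set) - card {x\<in>vecs A. dot A u x = 0}"
    using fin by (intro card_Diff_subset) auto
  finally show ?thesis by (simp add: c0 cv diff_mult_distrib)
qed

text \<open>The function \<open>g\<close>: by how much the indicator of \<open>c \<noteq> 0\<close> increases when \<open>s\<close> is added to \<open>c\<close>.\<close>
definition hit_diff :: "'a::group_add \<Rightarrow> 'a \<Rightarrow> int" where
  "hit_diff s c = of_bool (c = 0) - of_bool (c = - s)"

lemma sum_hit_diff: "sum (hit_diff s) (UNIV :: 'a::{group_add,finite} set) = 0"
  by (simp add: hit_diff_def sum_subtractf)

lemma codeword_wt_indicator:
  fixes u :: "'i \<Rightarrow> 'a::{field,finite}"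
  assumes "finite A" "D \<subseteq> vecs A" "zero_vec A \<in> D" "s \<noteq> 0"
  shows "int (codeword_wt A (indicator (D - {zero_vec A})) s u) =
    int (codeword_wt A (indicator (D - {zero_vec A})) 0 u) - 1 + (\<Sum>x\<in>D. hit_diff s (dot A u x))"
proof -
  let ?X = "vecs A - {zero_vec A} :: ('i \<Rightarrow> 'a) set"
  have fin: "finite ?X" using finite_vecs[OF assms(1)] by simp
  have finD: "finite D" using assms(2) finite_vecs[OF assms(1)] by (rule finite_subset)
  have "int (codeword_wt A (indicator (D - {zero_vec A})) s u) =
      (\<Sum>x\<in>?X. of_bool (dot A u x \<noteq> 0) + of_bool (x \<in> D) * hit_diff s (dot A u x))"
    unfolding codeword_wt_altdef int_card_filter[OF fin]
    using assms(4)
    by (intro sum.cong) (auto simp: hit_diff_def indicator_def eq_neg_iff_add_eq_0 add.commute)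
  also have "\<dots> = int (codeword_wt A (indicator (D - {zero_vec A})) 0 u) +
      (\<Sum>x\<in>?X. of_bool (x \<in> D) * hit_diff s (dot A u x))"
    unfolding codeword_wt_altdef int_card_filter[OF fin] by (simp add: sum.distrib)
  also have "(\<Sum>x\<in>?X. of_bool (x \<in> D) * hit_diff s (dot A u x)) =
      (\<Sum>x\<in>D - {zero_vec A}. hit_diff s (dot A u x))"
    using assms(2) fin by (intro sum.mono_neutral_cong_right) auto
  also have "\<dots> = (\<Sum>x\<in>D. hit_diff s (dot A u x)) - 1"
    using assms finD by (simp add: sum_diff1 hit_diff_def)
  finally show ?thesis by simp
qed

section \<open>Ideals of the hierarchical poset as a union of two products\<close>

text \<open>A set of multisets given by independent conditions on the multiplicities corresponds to a product
  of coordinate sets.\<close>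
lemma mult_vec_image_box:
  assumes "finite P"
  shows "mult_vec P ` {J. set_mset J \<subseteq> P \<and> (\<forall>i\<in>P. count J i \<in> K i)} =
    (PiE P (\<lambda>i. of_nat ` K i) :: ('i \<Rightarrow> 'p::prime_card mod_ring) set)"
proof (intro equalityI subsetI)
  fix x :: "'i \<Rightarrow> 'p mod_ring"
  assume x: "x \<in> PiE P (\<lambda>i. of_nat ` K i)"
  then have "\<forall>i\<in>P. \<exists>k. k \<in> K i \<and> x i = of_nat k" by (auto simp: PiE_iff)
  then obtain h where h: "\<And>i. i \<in> P \<Longrightarrow> h i \<in> K i \<and> x i = of_nat (h i)"
    by metis
  define J where "J = Abs_multiset (\<lambda>i. if i \<in> P then h i else 0)"
  have cnt: "count J i = (if i \<in> P then h i else 0)" for i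
    unfolding J_def using assms by (subst Abs_multiset_inverse) (auto intro: finite_subset)
  have "mult_vec P J = x"
    using x h by (auto simp: mult_vec_def cnt fun_eq_iff PiE_def extensional_def)
  moreover have "set_mset J \<subseteq> P" "\<forall>i\<in>P. count J i \<in> K i"
    using h by (auto simp: cnt set_mset_def split: if_splits)
  ultimately show "x \<in> mult_vec P ` {J. set_mset J \<subseteq> P \<and> (\<forall>i\<in>P. count J i \<in> K i)}"
    by blast
qed (auto simp: mult_vec_def)

lemma of_nat_image_mod_ring:
  fixes r :: nat
  assumes r: "r = CARD('p) - 1"
  shows "of_nat ` {..r} = (UNIV :: 'p::prime_card mod_ring set)"
    and "of_nat ` {1..r} = (UNIV - {0} :: 'p mod_ring set)"
    and "of_nat ` {r} = ({- 1} :: 'p mod_ring set)"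
proof -
  have r0: "0 < r" "r < CARD('p)"
    using prime_gt_1_nat[OF prime_card[where 'a='p]] r by simp_all
  show all: "of_nat ` {..r} = (UNIV :: 'p mod_ring set)"
  proof -
    have "x \<in> of_nat ` {..r}" for x :: "'p mod_ring"
      using surj_of_nat_mod_ring[of x] r by fastforce
    then show ?thesis by blast
  qed
  have nz: "of_nat k \<noteq> (0 :: 'p mod_ring)" if "k \<in> {1..r}" for k
  proof
    assume "of_nat k = (0 :: 'p mod_ring)"
    then have "CARD('p) dvd k" by (rule of_nat_0_mod_ring_dvd)
    with that r0 show False by (auto dest: dvd_imp_le)
  qed
  have "{..r} = insert 0 {1..r}" by auto
  then have "insert 0 (of_nat ` {1..r}) = (UNIV :: 'p mod_ring set)"
    using all by (metis image_insert of_nat_0)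
  moreover have "(0 :: 'p mod_ring) \<notin> of_nat ` {1..r}"
    using nz by (metis imageE)
  ultimately show "of_nat ` {1..r} = (UNIV - {0} :: 'p mod_ring set)" by blast
  have "of_nat r + (1 :: 'p mod_ring) = of_nat CARD('p)"
    using r0 r by (metis Suc_diff_1 add.commute gr_implies_not0 not_gr_zero of_nat_Suc)
  then show "of_nat ` {r} = ({- 1} :: 'p mod_ring set)"
    by (simp add: eq_neg_iff_add_eq_0)
qed

lemma subset_uniform_mset_iff:
  "finite A \<Longrightarrow> J \<subseteq># uniform_mset r A \<longleftrightarrow> (\<forall>i. count J i \<le> (if i \<in> A then r else 0))"
  by (simp add: subseteq_mset_def uniform_mset_def count_mset_set')

text \<open>Vectors over \<open>[n]\<close> with coordinates in \<open>Y\<close> on \<open>[m]\<close>, in \<open>Z\<close> on \<open>B\<close> and zero elsewhere.\<close>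
definition box :: "nat \<Rightarrow> nat \<Rightarrow> nat set \<Rightarrow> 'a::zero set \<Rightarrow> 'a set \<Rightarrow> (nat \<Rightarrow> 'a) set" where
  "box m n B Y Z = PiE {1..n} (\<lambda>i. if i \<le> m then Y else if i \<in> B then Z else {0})"

text \<open>The multiplicities, and the corresponding field elements, allowed at an element of \<open>[m]\<close> in an
  ideal that contains some element above it. The maximal multiplicity \<open>r = p - 1\<close> becomes \<open>- 1\<close>.\<close>
definition lower_mults :: "ideal_type \<Rightarrow> nat \<Rightarrow> nat set" where
  "lower_mults T r = (case T of Unsaturated \<Rightarrow> {1..r} | Saturated \<Rightarrow> {r})"

definition lower_coords :: "ideal_type \<Rightarrow> 'a::ring_1 set" where
  "lower_coords T = (case T of Unsaturated \<Rightarrow> UNIV - {0} | Saturated \<Rightarrow> {- 1})"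

text \<open>The second family also contains ideals that miss \<open>B\<close>, so the two families overlap.\<close>
lemma gen_order_ideals_hier:
  fixes r m n :: nat
  assumes r: "1 \<le> r" and m: "m \<le> n" and B: "B \<subseteq> {1..n} - {1..m}"
  defines "mbox \<equiv> (\<lambda>K L. {J. set_mset J \<subseteq> {1..n} \<and>
      (\<forall>i\<in>{1..n}. count J i \<in> (if i \<le> m then K else if i \<in> B then L else {0}))})"
  shows "{J. gen_order_ideal T r {1..n} (hier_less m n) J \<and> J \<subseteq># uniform_mset r ({1..m} \<union> B)} =
    mbox {..r} {0} \<union> mbox (lower_mults T r) {..r}"
proof -
  have finB: "finite B" using B finite_subset by blast
  note sub = subset_uniform_mset_iff[of "{1..m} \<union> B" _ r] subset_uniform_mset_iff[of "{1..n}" _ r]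
  have "(gen_order_ideal T r {1..n} (hier_less m n) J \<and> J \<subseteq># uniform_mset r ({1..m} \<union> B)) \<longleftrightarrow>
      J \<in> mbox {..r} {0} \<or> J \<in> mbox (lower_mults T r) {..r}" (is "?L \<longleftrightarrow> ?R") for J
  proof
    assume L: ?L
    then have sub1: "J \<subseteq># uniform_mset r ({1..m} \<union> B)"
      and ideal: "order_ideal {1..n} (hier_less m n) (set_mset J)"
      by (cases T; simp)+
    have le: "count J i \<le> (if i \<in> {1..m} \<union> B then r else 0)" for i
      using sub1 sub(1) finB by blast
    have low: "set_mset J \<subseteq> {1..n}" using ideal by (simp add: order_ideal_def)
    show ?R
    proof (cases "\<forall>j\<in>B. count J j = 0")
      case True
      have "count J i \<in> (if i \<le> m then {..r} else if i \<in> B then {0} else {0})"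
        if "i \<in> {1..n}" for i
        using that le[of i] True by (auto split: if_splits)
      with low show ?thesis by (simp add: mbox_def)
    next
      case False
      then obtain j where j: "j \<in> B" "j \<in># J" by (auto simp: not_in_iff)
      have ij: "hier_less m n i j" "i \<in> {1..n}" if "i \<in> {1..m}" for i
        using that j(1) B m by (auto simp: hier_less_def)
      have "i \<in># J" if "i \<in> {1..m}" for i
        using ideal j(2) ij[OF that] by (auto simp: order_ideal_def)
      then have pos: "1 \<le> count J i" if "i \<in> {1..m}" for i
        using that by (simp add: Suc_leI)
      have "count J i \<in> lower_mults T r" if "i \<in> {1..m}" for i
      proof (cases T)
        case Unsaturated
        then show ?thesis using pos[OF that] le[of i] that by (simp add: lower_mults_def)
      next
        case Saturated
        then have "count J i = r" using L j(2) ij[OF that] by auto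
        then show ?thesis using Saturated by (simp add: lower_mults_def)
      qed
      then have "count J i \<in> (if i \<le> m then lower_mults T r else if i \<in> B then {..r} else {0})"
        if "i \<in> {1..n}" for i
        using that le[of i] by (auto split: if_splits)
      with low show ?thesis by (simp add: mbox_def)
    qed
  next
    assume R: ?R
    have lm: "lower_mults T r \<subseteq> {1..r}"
      using r by (cases T) (auto simp: lower_mults_def)
    have low: "set_mset J \<subseteq> {1..n}" using R by (auto simp: mbox_def)
    have le: "count J i \<le> (if i \<in> {1..m} \<union> B then r else 0)" for i
    proof (cases "i \<in> {1..n}")
      case True
      have "count J i \<in> (if i \<le> m then {..r} else if i \<in> B then {0} else {0}) \<or>
          count J i \<in> (if i \<le> m then lower_mults T r else if i \<in> B then {..r} else {0})"
        using R True unfolding mbox_def by blast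
      then show ?thesis using True subsetD[OF lm, of "count J i"] by (auto split: if_splits)
    next
      case False
      then have "count J i = 0" using low by (auto simp: not_in_iff)
      then show ?thesis by simp
    qed
    then have sub1: "J \<subseteq># uniform_mset r ({1..m} \<union> B)"
      using sub(1) finB by blast
    have "count J i \<le> (if i \<in> {1..n} then r else 0)" for i
      using le[of i] m B by (auto split: if_splits)
    then have sub2: "J \<subseteq># uniform_mset r {1..n}"
      using sub(2) by blast
    have key: "count J i \<in> lower_mults T r" if "j \<in># J" "hier_less m n i j" for i j
    proof -
      have jj: "j \<in> {1..n}" "\<not> j \<le> m" "count J j \<noteq> 0" and ii: "i \<in> {1..n}" "i \<le> m"
        using that m by (auto simp: hier_less_def)
      \<comment> \<open>An element outside \<open>[m]\<close> in the support excludes the first family.\<close>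
      have "J \<notin> mbox {..r} {0}"
        using jj by (auto simp: mbox_def)
      then have "\<forall>i\<in>{1..n}. count J i \<in> (if i \<le> m then lower_mults T r else if i \<in> B then {..r} else {0})"
        using R unfolding mbox_def by blast
      from bspec[OF this ii(1)] show ?thesis using ii(2) by simp
    qed
    have "i \<in># J" if "j \<in># J" "hier_less m n i j" for i j
      using key[OF that] lm by (auto simp: Suc_le_eq subset_iff)
    then have "order_ideal {1..n} (hier_less m n) (set_mset J)"
      using low by (auto simp: order_ideal_def)
    moreover have "count J i = r" if "T = Saturated" "j \<in># J" "hier_less m n i j" for i j
      using key[OF that(2,3)] that(1) by (simp add: lower_mults_def)
    ultimately show ?L using sub1 sub2 by (cases T) auto
  qed
  then show ?thesis by blast
qed

lemma ideals_within_hier: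
  fixes r m n :: nat
  assumes r: "r = CARD('p) - 1" and m: "m \<le> n" and B: "B \<subseteq> {1..n} - {1..m}"
  shows "ideals_within T {1..n} (hier_less m n) (uniform_mset r ({1..m} \<union> B)) =
    (box m n B UNIV {0} \<union> box m n B (lower_coords T) UNIV :: (nat \<Rightarrow> 'p::prime_card mod_ring) set)"
proof -
  have r1: "1 \<le> r"
    using prime_gt_1_nat[OF prime_card[where 'a='p]] r by simp
  have img: "of_nat ` lower_mults T r = (lower_coords T :: 'p mod_ring set)"
    using of_nat_image_mod_ring[OF r] by (cases T) (simp_all add: lower_mults_def lower_coords_def)
  have box_img: "mult_vec {1..n} ` {J. set_mset J \<subseteq> {1..n} \<and>
        (\<forall>i\<in>{1..n}. count J i \<in> (if i \<le> m then K else if i \<in> B then L else {0}))} =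
      (box m n B (of_nat ` K) (of_nat ` L) :: (nat \<Rightarrow> 'p mod_ring) set)" for K L
    unfolding mult_vec_image_box[OF finite_atLeastAtMost] box_def
    by (rule PiE_cong) simp
  show ?thesis
    unfolding ideals_within_def r[symmetric] gen_order_ideals_hier[OF r1 m B] image_Un box_img
    by (simp only: of_nat_image_mod_ring(1)[OF r] img image_insert image_empty of_nat_0)
qed

section \<open>The sum over all ideals\<close>

lemma sum_hier_box:
  fixes g :: "'a::{comm_semiring_0,finite} \<Rightarrow> int"
  assumes m: "m \<le> n" and B: "B \<subseteq> {1..n} - {1..m}"
    and Y: "\<And>i d. i \<in> {1..m} \<Longrightarrow> (\<Sum>c\<in>Y. g (d + u i * c)) = \<mu> i * g (d + \<tau> i)"
    and Z: "\<And>i d. i \<in> B \<Longrightarrow> (\<Sum>c\<in>Z. g (d + u i * c)) = \<nu> i * g d"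
  shows "(\<Sum>x\<in>box m n B Y Z. g (dot {1..n} u x)) =
    (\<Prod>i\<in>{1..m}. \<mu> i) * (\<Prod>i\<in>B. \<nu> i) * g (\<Sum>i\<in>{1..m}. \<tau> i)"
proof -
  define \<mu>' where "\<mu>' i = (if i \<le> m then \<mu> i else if i \<in> B then \<nu> i else 1)" for i
  define \<tau>' where "\<tau>' i = (if i \<le> m then \<tau> i else 0)" for i
  have finB: "finite B" using B finite_subset by blast
  have "(\<Sum>x\<in>box m n B Y Z. g (0 + dot {1..n} u x)) =
      (\<Prod>i\<in>{1..n}. \<mu>' i) * g (0 + (\<Sum>i\<in>{1..n}. \<tau>' i))"
    unfolding box_def
    by (intro sum_box) (auto simp: Y Z \<mu>'_def \<tau>'_def)
  moreover have "(\<Prod>i\<in>{1..n}. \<mu>' i) = (\<Prod>i\<in>{1..m} \<union> B. \<mu>' i)"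
    using m B by (intro prod.mono_neutral_right) (auto simp: \<mu>'_def)
  moreover have "\<dots> = (\<Prod>i\<in>{1..m}. \<mu>' i) * (\<Prod>i\<in>B. \<mu>' i)"
    using B finB by (intro prod.union_disjoint) auto
  moreover have "(\<Prod>i\<in>{1..m}. \<mu>' i) = (\<Prod>i\<in>{1..m}. \<mu> i)" "(\<Prod>i\<in>B. \<mu>' i) = (\<Prod>i\<in>B. \<nu> i)"
    using B by (auto intro!: prod.cong simp: \<mu>'_def)
  moreover have "(\<Sum>i\<in>{1..n}. \<tau>' i) = (\<Sum>i\<in>{1..m}. \<tau> i)"
    using m by (intro sum.mono_neutral_cong_right) (auto simp: \<tau>'_def)
  ultimately show ?thesis by simp
qed

lemma prod_const_of_bool:
  fixes c :: "'a::comm_semiring_1"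
  shows "finite A \<Longrightarrow> (\<Prod>i\<in>A. c * of_bool (P i)) = c ^ card A * of_bool (\<forall>i\<in>A. P i)"
  by (induction A rule: finite_induct) auto

text \<open>The factor \<open>E\<close> contributed by the coordinates in \<open>[m]\<close> when they range over \<open>lower_coords T\<close>;
  its saturated value is \<open>g (- \<sigma>) = [\<sigma> = 0] - [\<sigma> = s]\<close>.\<close>
definition lower_factor :: "ideal_type \<Rightarrow> nat \<Rightarrow> (nat \<Rightarrow> 'a::{field,finite}) \<Rightarrow> 'a \<Rightarrow> int" where
  "lower_factor T m u s = (case T of
     Unsaturated \<Rightarrow> (- 1) ^ hamming_wt {1..m} u * (int CARD('a) - 1) ^ (m - hamming_wt {1..m} u)
   | Saturated \<Rightarrow> hit_diff s (- (\<Sum>i\<in>{1..m}. u i)))"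

lemma sum_lower_box:
  fixes u :: "nat \<Rightarrow> 'a::{field,finite}"
  assumes m: "m \<le> n" and B: "B \<subseteq> {1..n} - {1..m}" and s: "s \<noteq> 0"
    and Z: "\<And>i d. i \<in> B \<Longrightarrow> (\<Sum>c\<in>Z. hit_diff s (d + u i * c)) = \<nu> i * hit_diff s d"
  shows "(\<Sum>x\<in>box m n B (lower_coords T) Z. hit_diff s (dot {1..n} u x)) =
    lower_factor T m u s * (\<Prod>i\<in>B. \<nu> i)"
proof (cases T)
  case Unsaturated
  let ?q = "int CARD('a)" and ?N = "{i\<in>{1..m}. u i \<noteq> 0}"
  have "(\<Prod>i\<in>{1..m}. ?q * of_bool (u i = 0) - 1) = (\<Prod>i\<in>{1..m}. if u i \<noteq> 0 then - 1 else ?q - 1)"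
    by (intro prod.cong) auto
  also have "\<dots> = (- 1) ^ card ?N * (?q - 1) ^ card ({1..m} - ?N)"
    by (subst prod.If_cases) (auto intro!: arg_cong2[where f="(*)"] arg_cong2[where f="(^)"] arg_cong[where f=card])
  also have "card ({1..m} - ?N) = m - card ?N"
    by (subst card_Diff_subset) auto
  finally have pr: "(\<Prod>i\<in>{1..m}. ?q * of_bool (u i = 0) - 1) = lower_factor T m u s"
    using Unsaturated by (simp add: lower_factor_def hamming_wt_def)
  have "(\<Sum>x\<in>box m n B (UNIV - {0}) Z. hit_diff s (dot {1..n} u x)) =
      (\<Prod>i\<in>{1..m}. ?q * of_bool (u i = 0) - 1) * (\<Prod>i\<in>B. \<nu> i) * hit_diff s (\<Sum>i\<in>{1..m}. 0)"
    using m B Z by (intro sum_hier_box) (simp_all add: sum_affine_nonzero[OF sum_hit_diff])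
  then show ?thesis
    unfolding pr using s Unsaturated by (simp add: lower_coords_def hit_diff_def)
next
  case Saturated
  have "(\<Sum>x\<in>box m n B {- 1} Z. hit_diff s (dot {1..n} u x)) =
      (\<Prod>i\<in>{1..m}. 1) * (\<Prod>i\<in>B. \<nu> i) * hit_diff s (\<Sum>i\<in>{1..m}. - u i)"
    using m B Z by (intro sum_hier_box) simp_all
  then show ?thesis
    using Saturated by (simp add: lower_coords_def lower_factor_def sum_negf)
qed

lemma sum_ideals_hit_diff:
  fixes u :: "nat \<Rightarrow> 'a::{field,finite}"
  assumes m: "m \<le> n" and B: "B \<subseteq> {1..n} - {1..m}" and s: "s \<noteq> 0"
  shows "(\<Sum>x\<in>box m n B UNIV {0} \<union> box m n B (lower_coords T) UNIV. hit_diff s (dot {1..n} u x)) =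
    int CARD('a) ^ m * of_bool (\<forall>i\<in>{1..m}. u i = 0) +
    lower_factor T m u s * (int CARD('a) ^ card B * of_bool (\<forall>i\<in>B. u i = 0) - 1)"
proof -
  let ?h = "\<lambda>x. hit_diff s (dot {1..n} u x)" and ?q = "int CARD('a)"
  let ?A1 = "box m n B UNIV {0}" and ?A2 = "box m n B (lower_coords T) UNIV"
  have finB: "finite B" using B finite_subset by blast
  have fin: "finite (box m n B Y Z :: (nat \<Rightarrow> 'a) set)" for Y Z
    unfolding box_def by (intro finite_PiE) auto
  have Int: "?A1 \<inter> ?A2 = (box m n B (lower_coords T) {0} :: (nat \<Rightarrow> 'a) set)"
    unfolding box_def PiE_Int by (intro PiE_cong) auto
  have "sum ?h ?A1 = (\<Prod>i\<in>{1..m}. ?q * of_bool (u i = 0)) * (\<Prod>i\<in>B. 1) * hit_diff s (\<Sum>i\<in>{1..m}. 0)"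
    using m B by (intro sum_hier_box) (simp_all add: sum_affine_UNIV[OF sum_hit_diff])
  then have 1: "sum ?h ?A1 = ?q ^ m * of_bool (\<forall>i\<in>{1..m}. u i = 0)"
    using s prod_const_of_bool[of "{1..m}" ?q "\<lambda>i. u i = 0"] by (simp add: hit_diff_def)
  have "sum ?h ?A2 = lower_factor T m u s * (\<Prod>i\<in>B. ?q * of_bool (u i = 0))"
    using m B s by (intro sum_lower_box) (simp_all add: sum_affine_UNIV[OF sum_hit_diff])
  then have 2: "sum ?h ?A2 = lower_factor T m u s * (?q ^ card B * of_bool (\<forall>i\<in>B. u i = 0))"
    using prod_const_of_bool[OF finB, of ?q "\<lambda>i. u i = 0"] by simp
  have "sum ?h (box m n B (lower_coords T) {0}) = lower_factor T m u s * (\<Prod>i\<in>B. 1)"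
    using m B s by (intro sum_lower_box) simp_all
  then have 3: "sum ?h (?A1 \<inter> ?A2) = lower_factor T m u s" unfolding Int by simp
  show ?thesis
    using sum.union_inter[of ?A1 ?A2 ?h, OF fin fin] 1 2 3
    by (simp add: algebra_simps)
qed

theorem lemma5p1:
  fixes p m n b k Q :: nat
    and B :: "nat set"
    and T :: ideal_type
    and I :: "nat multiset"
    and IGP :: "(nat \<Rightarrow> 'p::prime_card mod_ring) set"
    and f :: "(nat \<Rightarrow> 'p mod_ring) \<Rightarrow> 'p mod_ring"
    and s \<sigma> :: "'p mod_ring"
    and u v w :: "nat \<Rightarrow> 'p mod_ring"
    and \<delta> \<Phi> :: int
  assumes p: "p = CARD('p)" "odd p"
    and mn: "1 \<le> m" "m < n"
    and B: "B \<subseteq> {1..n} - {1..m}" "card B = b" "1 \<le> b"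
    and I: "I = uniform_mset (p - 1) ({1..m} \<union> B)"
    and IGP: "IGP = ideals_within T {1..n} (hier_less m n) I"
    and f: "f = indicator (IGP - {zero_vec {1..n}})"
    and Q: "Q = (p - 1) * p ^ (n - 1)"
    and u: "u \<in> vecs {1..n}"
    and v: "v = restrict u {1..m}"
    and w: "w = restrict u ({1..n} - {1..m})"
    and k: "k = hamming_wt {1..m} v"
    and \<sigma>: "\<sigma> = (\<Sum>i\<in>{1..m}. v i)"
    and \<delta>: "\<delta> = of_bool (\<forall>i\<in>B. w i = 0)"
    and \<Phi>: "\<Phi> = (case T of
        Unsaturated \<Rightarrow> (- 1) ^ k * (int p - 1) ^ (m - k) * (int p ^ b * \<delta> - 1)
      | Saturated \<Rightarrow> (int p ^ b * \<delta> - 1) * (of_bool (\<sigma> = 0) - of_bool (\<sigma> = s)))"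
  shows "(u \<noteq> zero_vec {1..n} \<longrightarrow> codeword_wt {1..n} f 0 u = Q) \<and>
    (s \<noteq> 0 \<longrightarrow> int (codeword_wt {1..n} f s (zero_vec {1..n})) = int (card IGP) - 1) \<and>
    (s \<noteq> 0 \<longrightarrow> u \<noteq> zero_vec {1..n} \<longrightarrow>
      int (codeword_wt {1..n} f s u) =
        int Q - 1 + int p ^ m * of_bool (v = zero_vec {1..m}) + \<Phi>)"
proof -
  let ?A = "{1..n}"
  have mn': "m \<le> n" using mn by simp
  have card_p: "CARD('p mod_ring) = p" using p by simp
  define D :: "(nat \<Rightarrow> 'p mod_ring) set"
    where "D = box m n B UNIV {0} \<union> box m n B (lower_coords T) UNIV"
  have IGP_D: "IGP = D"
    unfolding IGP I D_def using ideals_within_hier[OF _ mn' B(1), of "p - 1" T] p by blast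
  have D_vecs: "D \<subseteq> vecs ?A"
    by (auto simp: D_def box_def vecs_def PiE_def)
  have zero_D: "zero_vec ?A \<in> D"
    by (auto simp: D_def box_def zero_vec_def)
  have lin: "codeword_wt ?A f 0 u = Q" if "u \<noteq> zero_vec ?A"
    using codeword_wt_linear[OF _ u that, of f] card_p by (simp add: Q)
  have ind: "int (codeword_wt ?A f s y) = int (codeword_wt ?A f 0 y) - 1 + (\<Sum>x\<in>D. hit_diff s (dot ?A y x))"
    if "s \<noteq> 0" for y
    unfolding f IGP_D using codeword_wt_indicator[OF _ D_vecs zero_D that] by simp
  have "int (codeword_wt ?A f s (zero_vec ?A)) = int (card IGP) - 1" if "s \<noteq> 0"
  proof -
    have "codeword_wt ?A f 0 (zero_vec ?A) = 0"
      by (simp add: codeword_wt_altdef)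
    then show ?thesis
      using ind[OF that, of "zero_vec ?A"] that by (simp add: hit_diff_def IGP_D)
  qed
  moreover have "int (codeword_wt ?A f s u) =
      int Q - 1 + int p ^ m * of_bool (v = zero_vec {1..m}) + \<Phi>"
    if s: "s \<noteq> 0" and u0: "u \<noteq> zero_vec ?A"
  proof -
    have v0: "v = zero_vec {1..m} \<longleftrightarrow> (\<forall>i\<in>{1..m}. u i = 0)"
      unfolding v zero_vec_def by (auto simp: fun_eq_iff restrict_def)
    have w0: "(\<forall>i\<in>B. w i = 0) \<longleftrightarrow> (\<forall>i\<in>B. u i = 0)"
      unfolding w using B(1) by (intro ball_cong) auto
    have k': "k = hamming_wt {1..m} u"
      unfolding k v hamming_wt_def by (rule arg_cong[where f=card]) auto
    have \<sigma>': "\<sigma> = (\<Sum>i\<in>{1..m}. u i)" unfolding \<sigma> v by simp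
    have "\<Phi> = lower_factor T m u s * (int p ^ b * \<delta> - 1)"
      unfolding \<Phi> lower_factor_def k'[symmetric] \<sigma>'[symmetric] card_p
      by (cases T) (simp_all add: hit_diff_def)
    then show ?thesis
      using ind[OF s, of u] lin[OF u0] sum_ideals_hit_diff[OF mn' B(1) s, of u T]
      unfolding D_def[symmetric] card_p v0 w0 \<delta> B(2) by simp
  qed
  ultimately show ?thesis using lin by blast
qed

end
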